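(* If a weighted composition operator $C_{w,f}$ on $L^p(\mu)$ is mean Li-Yorke chaotic, then there exists a nonempty countable family $(B_i)_{i \in I}$ of measurable sets of finite positive $\mu$-measure such that \[ \liminf_{N \to \infty} \frac{1}{N} \sum_{n=1}^N \mu_n(f^{-n}(B_i))^{\frac{1}{p}} = 0 \quad \text{for all } i \in I \] and \[ \sup \Big\{\frac{1}{N} \sum_{n=1}^N \frac{\mu_n(f^{-n}(B_i))}{\mu(B_i)} : i \in I,\ N \in \mathbb{N} \Big\} = \infty. \]
   Context: Fix $\mathbb{K} = \mathbb{R}$ or $\mathbb{C}$, a real number $p \in [1,\infty)$ and an arbitrary positive measure space $(X,\mathfrak{M},\mu)$. $L^p(\mu)$ is the Banach space over $\mathbb{K}$ of all $\mathbb{K}$-valued $p$-integrable functions with norm $\|\varphi\|_p = (\int_X |\varphi|^p d\mu)^{1/p}$. A weighted composition operator on $L^p(\mu)$ is the map $C_{w,f}(\varphi) = (\varphi \circ f)\cdot w$, where $w : X \to \mathbb{K}$ is measurable with $\varphi\cdot w \in L^p(\mu)$ for all $\varphi \in L^p(\mu)$, $f : X \to X$ is bimeasurable (i.e. $f(B) \in \mathfrak{M}$ and $f^{-1}(B) \in \mathfrak{M}$ whenever $B \in \mathfrak{M}$), and there is a constant $c \in (0,\infty)$ such that $\int_B |w|^p d\mu \le c\,\mu(f(B))$ for every $B \in \mathfrak{M}$; these conditions make $C_{w,f}$ a well-defined bounded linear operator on $L^p(\mu)$. Put $w^{(1)} = w$, $w^{(n)} = (w\circ f^{n-1})\cdots(w\circ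 f)\cdot w$ for $n \ge 2$, and $\mu_n(B) = \int_B |w^{(n)}|^p d\mu$ for $B \in \mathfrak{M}$, $n \in \mathbb{N} = \{1,2,\ldots\}$. A map $g : M \to M$ on a metric space $(M,d)$ is mean Li-Yorke chaotic if there is an uncountable set $S \subset M$ such that for each pair $(x,y)$ of distinct points of $S$: $\liminf_{N\to\infty} \frac{1}{N}\sum_{n=1}^N d(g^n(x),g^n(y)) = 0$ and $\limsup_{N\to\infty} \frac{1}{N}\sum_{n=1}^N d(g^n(x),g^n(y)) > 0$. *)

theory Defs
  imports "HOL-Analysis.Analysis"
begin

section \<open>The Banach space of p-integrable functions as a metric space\<close>

text \<open>
  The scalar field is a type of sort \<open>{real_normed_field, euclidean_space}\<close>.  Both \<^typ>\<open>real\<close> and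
  \<^typ>\<open>complex\<close> are of this sort and, by the theorem of Frobenius (or Gelfand--Mazur), they are up to
  isometric isomorphism the only such fields.
\<close>

definition Lp_fun ::
  "'a measure \<Rightarrow> real \<Rightarrow> ('a \<Rightarrow> 'k::{real_normed_field, euclidean_space}) set" where
  "Lp_fun M p = {\<phi> \<in> borel_measurable M. integrable M (\<lambda>x. norm (\<phi> x) powr p)}"

definition Lp_eq ::
  "'a measure \<Rightarrow> real \<Rightarrow> (('a \<Rightarrow> 'k::{real_normed_field, euclidean_space}) \<times> ('a \<Rightarrow> 'k)) set" where
  "Lp_eq M p = {(\<phi>, \<psi>). \<phi> \<in> Lp_fun M p \<and> \<psi> \<in> Lp_fun M p \<and> (AE x in M. \<phi> x = \<psi> x)}"

definition Lp_class ::
  "'a measure \<Rightarrow> real \<Rightarrow> ('a \<Rightarrow> 'k::{real_normed_field, euclidean_space}) \<Rightarrow> ('a \<Rightarrow> 'k) set" where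
  "Lp_class M p \<phi> = Lp_eq M p `` {\<phi>}"

definition Lp ::
  "'a measure \<Rightarrow> real \<Rightarrow> ('a \<Rightarrow> 'k::{real_normed_field, euclidean_space}) set set" where
  "Lp M p = Lp_fun M p // Lp_eq M p"

definition Lp_rep :: "('a \<Rightarrow> 'k) set \<Rightarrow> 'a \<Rightarrow> 'k" where
  "Lp_rep c = (SOME \<phi>. \<phi> \<in> c)"

definition Lp_norm ::
  "'a measure \<Rightarrow> real \<Rightarrow> ('a \<Rightarrow> 'k::{real_normed_field, euclidean_space}) \<Rightarrow> real" where
  "Lp_norm M p \<phi> = (LINT x|M. norm (\<phi> x) powr p) powr (1 / p)"

text \<open>
  The distance, and below the operator, are computed on arbitrary representatives; independence of
  the choice is shown in \<open>Lp_dist_class\<close> and \<open>weighted_comp_op_class\<close>.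
\<close>

definition Lp_dist ::
  "'a measure \<Rightarrow> real \<Rightarrow> ('a \<Rightarrow> 'k::{real_normed_field, euclidean_space}) set \<Rightarrow> ('a \<Rightarrow> 'k) set \<Rightarrow> real"
  where "Lp_dist M p a b = Lp_norm M p (\<lambda>x. Lp_rep a x - Lp_rep b x)"

lemma equiv_Lp_eq:
  "equiv (Lp_fun M p :: ('a \<Rightarrow> 'k::{real_normed_field, euclidean_space}) set) (Lp_eq M p)"
proof (rule equivI)
  show "sym (Lp_eq M p :: (('a \<Rightarrow> 'k) \<times> _) set)"
    by (rule symI) (auto simp: Lp_eq_def eq_commute)
  show "trans (Lp_eq M p :: (('a \<Rightarrow> 'k) \<times> _) set)"
  proof (rule transI)
    fix \<phi> \<psi> \<theta> :: "'a \<Rightarrow> 'k" assume a: "(\<phi>, \<psi>) \<in> Lp_eq M p" "(\<psi>, \<theta>) \<in> Lp_eq M p"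
    have "AE x in M. \<phi> x = \<psi> x" "AE x in M. \<psi> x = \<theta> x"
      using a by (simp_all add: Lp_eq_def)
    then have "AE x in M. \<phi> x = \<theta> x"
      by eventually_elim simp
    then show "(\<phi>, \<theta>) \<in> Lp_eq M p"
      using a by (simp add: Lp_eq_def)
  qed
qed (auto simp: Lp_eq_def refl_on_def)

lemma Lp_class_in_Lp: "\<phi> \<in> Lp_fun M p \<Longrightarrow> Lp_class M p \<phi> \<in> Lp M p"
  by (simp add: Lp_class_def Lp_def quotientI)

lemma Lp_cases:
  assumes "c \<in> Lp M p"
  obtains \<phi> where "\<phi> \<in> Lp_fun M p" "c = Lp_class M p \<phi>"
  using assms unfolding Lp_def Lp_class_def by (auto elim: quotientE)

lemma Lp_class_eq_iff:
  assumes "\<phi> \<in> Lp_fun M p" "\<psi> \<in> Lp_fun M p"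
  shows "Lp_class M p \<phi> = Lp_class M p \<psi> \<longleftrightarrow> (AE x in M. \<phi> x = \<psi> x)"
  using eq_equiv_class_iff[OF equiv_Lp_eq assms] assms by (simp add: Lp_class_def Lp_eq_def)

lemma Lp_rep_class:
  assumes "\<phi> \<in> Lp_fun M p"
  shows "Lp_rep (Lp_class M p \<phi>) \<in> Lp_fun M p" "AE x in M. Lp_rep (Lp_class M p \<phi>) x = \<phi> x"
proof -
  have "\<phi> \<in> Lp_class M p \<phi>"
    using assms by (simp add: Lp_class_def Lp_eq_def)
  then have "Lp_rep (Lp_class M p \<phi>) \<in> Lp_class M p \<phi>"
    unfolding Lp_rep_def by (rule someI[where P = "\<lambda>\<psi>. \<psi> \<in> Lp_class M p \<phi>"])
  then show "Lp_rep (Lp_class M p \<phi>) \<in> Lp_fun M p" "AE x in M. Lp_rep (Lp_class M p \<phi>) x = \<phi> x"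
    by (auto simp: Lp_class_def Lp_eq_def)
qed

lemma Lp_norm_cong_AE:
  assumes "\<phi> \<in> borel_measurable M" "\<psi> \<in> borel_measurable M" "AE x in M. \<phi> x = \<psi> x"
  shows "Lp_norm M p \<phi> = Lp_norm M p \<psi>"
proof -
  have "(LINT x|M. norm (\<phi> x) powr p) = (LINT x|M. norm (\<psi> x) powr p)"
    using assms by (intro integral_cong_AE) auto
  then show ?thesis by (simp add: Lp_norm_def)
qed

lemma Lp_dist_class:
  assumes "\<phi> \<in> Lp_fun M p" "\<psi> \<in> Lp_fun M p"
  shows "Lp_dist M p (Lp_class M p \<phi>) (Lp_class M p \<psi>) = Lp_norm M p (\<lambda>x. \<phi> x - \<psi> x)"
proof -
  note r = Lp_rep_class[OF assms(1)] Lp_rep_class[OF assms(2)]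
  show ?thesis unfolding Lp_dist_def
  proof (rule Lp_norm_cong_AE)
    show "AE x in M. Lp_rep (Lp_class M p \<phi>) x - Lp_rep (Lp_class M p \<psi>) x = \<phi> x - \<psi> x"
      using r(2,4) by eventually_elim simp
  qed (use r assms in \<open>auto simp: Lp_fun_def\<close>)
qed

lemma powr_convex_nonneg:
  fixes p t x y :: real
  assumes "1 \<le> p" "0 \<le> t" "t \<le> 1" "0 \<le> x" "0 \<le> y"
  shows "((1 - t) * x + t * y) powr p \<le> (1 - t) * x powr p + t * y powr p"
proof -
  have scale: "(s * z) powr p \<le> s * z powr p" if "0 \<le> s" "s \<le> 1" "0 \<le> z" for s z :: real
  proof -
    have "s powr p \<le> s powr 1"
      using powr_mono'[of 1 p s] that assms(1) by (cases "s = 0") auto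
    then have "s powr p * z powr p \<le> s * z powr p"
      using that by (intro mult_right_mono) auto
    then show ?thesis
      using that by (simp add: powr_mult)
  qed
  consider "x = 0" | "y = 0" | "x > 0" "y > 0" using assms by linarith
  then show ?thesis
  proof cases
    case 1 then show ?thesis using scale[of t y] assms by simp
  next
    case 2 then show ?thesis using scale[of "1 - t" x] assms by simp
  next
    case 3 then show ?thesis
      using convex_onD[OF powr_convex[OF assms(1)], of t x y] assms by simp
  qed
qed

lemma norm_add_powr_le:
  fixes u v :: "'k::real_normed_vector"
  assumes "1 \<le> p" "0 < a" "0 < b"
  shows "norm (u + v) powr p \<le>
    (a + b) powr p * (a / (a + b) / a powr p * norm u powr p + b / (a + b) / b powr p * norm v powr p)"
proof -
  define t where "t = b / (a + b)"
  have t: "0 \<le> t" "t \<le> 1" "1 - t = a / (a + b)"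
    using assms by (auto simp: t_def field_simps)
  have "(1 - t) * (norm u / a) + t * (norm v / b)
      = a / (a + b) * (norm u / a) + b / (a + b) * (norm v / b)"
    by (simp only: t(3)) (simp add: t_def)
  also have "\<dots> = (norm u + norm v) / (a + b)"
    using assms by (simp add: add_divide_distrib)
  finally have "(1 - t) * (norm u / a) + t * (norm v / b) = (norm u + norm v) / (a + b)" .
  then have eq: "norm u + norm v = (a + b) * ((1 - t) * (norm u / a) + t * (norm v / b))"
    using assms by simp
  have "norm (u + v) powr p \<le> (norm u + norm v) powr p"
    using assms by (intro powr_mono2 norm_triangle_ineq) auto
  also have "\<dots> = (a + b) powr p * ((1 - t) * (norm u / a) + t * (norm v / b)) powr p"
    using t assms by (subst eq, subst powr_mult) auto
  also have "\<dots> \<le> (a + b) powr p * ((1 - t) * (norm u / a) powr p + t * (norm v / b) powr p)"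
    using t assms by (intro mult_left_mono powr_convex_nonneg) auto
  finally show ?thesis
    using assms by (simp add: t(3)) (simp add: t_def powr_divide mult_ac)
qed

lemma Lp_fun_add:
  assumes "1 \<le> p" "\<phi> \<in> Lp_fun M p" "\<psi> \<in> Lp_fun M p"
  shows "(\<lambda>x. \<phi> x + \<psi> x) \<in> Lp_fun M p"
proof -
  have "integrable M (\<lambda>x. norm (\<phi> x + \<psi> x) powr p)"
  proof (rule Bochner_Integration.integrable_bound)
    show "integrable M (\<lambda>x. (1 + 1) powr p * (1 / (1 + 1) / 1 powr p * norm (\<phi> x) powr p
        + 1 / (1 + 1) / 1 powr p * norm (\<psi> x) powr p))"
      using assms by (intro integrable_mult_right integrable_add) (auto simp: Lp_fun_def)
    show "AE x in M. norm (norm (\<phi> x + \<psi> x) powr p) \<le>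
      norm ((1 + 1) powr p * (1 / (1 + 1) / 1 powr p * norm (\<phi> x) powr p
        + 1 / (1 + 1) / 1 powr p * norm (\<psi> x) powr p))"
      using norm_add_powr_le[OF assms(1), of 1 1] by (intro AE_I2) force
  qed (use assms in \<open>auto simp: Lp_fun_def\<close>)
  then show ?thesis
    using assms by (auto simp: Lp_fun_def)
qed

lemma Lp_fun_minus: "\<phi> \<in> Lp_fun M p \<Longrightarrow> (\<lambda>x. - \<phi> x) \<in> Lp_fun M p"
  by (auto simp: Lp_fun_def)

lemma Lp_fun_diff:
  assumes "1 \<le> p" "\<phi> \<in> Lp_fun M p" "\<psi> \<in> Lp_fun M p"
  shows "(\<lambda>x. \<phi> x - \<psi> x) \<in> Lp_fun M p"
  using Lp_fun_add[OF assms(1,2) Lp_fun_minus[OF assms(3)]] by simp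

lemma Lp_norm_powr:
  assumes "1 \<le> p"
  shows "Lp_norm M p \<phi> powr p = (LINT x|M. norm (\<phi> x) powr p)"
  using assms by (simp add: Lp_norm_def powr_powr)

lemma Lp_norm_triangle:
  assumes p: "1 \<le> p" and \<phi>: "\<phi> \<in> Lp_fun M p" and \<psi>: "\<psi> \<in> Lp_fun M p"
  shows "Lp_norm M p (\<lambda>x. \<phi> x + \<psi> x) \<le> Lp_norm M p \<phi> + Lp_norm M p \<psi>"
proof (rule field_le_epsilon)
  fix e :: real assume e: "0 < e"
  define a b where "a = Lp_norm M p \<phi> + e / 2" and "b = Lp_norm M p \<psi> + e / 2"
  have nn: "0 \<le> Lp_norm M p \<phi>" "0 \<le> Lp_norm M p \<psi>"
    by (auto simp: Lp_norm_def)
  have ab: "0 < a" "0 < b"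
    using nn e by (auto simp: a_def b_def)
  have le: "(LINT x|M. norm (\<phi> x) powr p) \<le> a powr p" "(LINT x|M. norm (\<psi> x) powr p) \<le> b powr p"
    unfolding Lp_norm_powr[OF p, symmetric] using nn e p
    by (auto simp: a_def b_def intro!: powr_mono2)
  have int: "integrable M (\<lambda>x. norm (\<phi> x) powr p)" "integrable M (\<lambda>x. norm (\<psi> x) powr p)"
    using \<phi> \<psi> by (auto simp: Lp_fun_def)
  have "(LINT x|M. norm (\<phi> x + \<psi> x) powr p) \<le> (LINT x|M. (a + b) powr p *
      (a / (a + b) / a powr p * norm (\<phi> x) powr p + b / (a + b) / b powr p * norm (\<psi> x) powr p))"
    using Lp_fun_add[OF p \<phi> \<psi>] int norm_add_powr_le[OF p ab]
    by (intro integral_mono integrable_mult_right integrable_add) (auto simp: Lp_fun_def)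
  also have "\<dots> = (a + b) powr p * (a / (a + b) / a powr p * (LINT x|M. norm (\<phi> x) powr p)
      + b / (a + b) / b powr p * (LINT x|M. norm (\<psi> x) powr p))"
    using int by simp
  also have "\<dots> \<le> (a + b) powr p *
      (a / (a + b) / a powr p * a powr p + b / (a + b) / b powr p * b powr p)"
    using ab le by (intro mult_left_mono add_mono) auto
  also have "\<dots> = (a + b) powr p"
    using ab by (simp add: add_divide_distrib[symmetric])
  finally have "Lp_norm M p (\<lambda>x. \<phi> x + \<psi> x) \<le> ((a + b) powr p) powr (1 / p)"
    unfolding Lp_norm_def using p by (intro powr_mono2) auto
  also have "\<dots> = a + b"
    using ab p by (simp add: powr_powr)
  finally show "Lp_norm M p (\<lambda>x. \<phi> x + \<psi> x) \<le> Lp_norm M p \<phi> + Lp_norm M p \<psi> + e"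
    by (simp add: a_def b_def)
qed

lemma Lp_norm_eq_0_iff:
  assumes "1 \<le> p" "\<phi> \<in> Lp_fun M p"
  shows "Lp_norm M p \<phi> = 0 \<longleftrightarrow> (AE x in M. \<phi> x = 0)"
  using assms integral_nonneg_eq_0_iff_AE[of M "\<lambda>x. norm (\<phi> x) powr p"]
  by (auto simp: Lp_norm_def Lp_fun_def)

lemma Metric_space_Lp:
  assumes p: "1 \<le> p"
  shows "Metric_space (Lp M p) (Lp_dist M p)"
proof
  fix a b :: "('a \<Rightarrow> 'b) set"
  show "0 \<le> Lp_dist M p a b"
    by (simp add: Lp_dist_def Lp_norm_def)
  show "Lp_dist M p a b = Lp_dist M p b a"
    by (simp add: Lp_dist_def Lp_norm_def norm_minus_commute)
next
  fix a b :: "('a \<Rightarrow> 'b) set" assume a: "a \<in> Lp M p" and b: "b \<in> Lp M p"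
  obtain \<phi> where "\<phi> \<in> Lp_fun M p" "a = Lp_class M p \<phi>" by (rule Lp_cases[OF a])
  moreover obtain \<psi> where "\<psi> \<in> Lp_fun M p" "b = Lp_class M p \<psi>" by (rule Lp_cases[OF b])
  ultimately show "Lp_dist M p a b = 0 \<longleftrightarrow> a = b"
    using p by (simp add: Lp_dist_class Lp_class_eq_iff Lp_norm_eq_0_iff Lp_fun_diff)
next
  fix a b c :: "('a \<Rightarrow> 'b) set"
  assume a: "a \<in> Lp M p" and b: "b \<in> Lp M p" and c: "c \<in> Lp M p"
  obtain \<phi> where "\<phi> \<in> Lp_fun M p" "a = Lp_class M p \<phi>" by (rule Lp_cases[OF a])
  moreover obtain \<psi> where "\<psi> \<in> Lp_fun M p" "b = Lp_class M p \<psi>" by (rule Lp_cases[OF b])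
  moreover obtain \<theta> where "\<theta> \<in> Lp_fun M p" "c = Lp_class M p \<theta>" by (rule Lp_cases[OF c])
  ultimately show "Lp_dist M p a c \<le> Lp_dist M p a b + Lp_dist M p b c"
    using Lp_norm_triangle[OF p Lp_fun_diff[OF p, of \<phi> M \<psi>] Lp_fun_diff[OF p, of \<psi> M \<theta>]]
    by (simp add: Lp_dist_class)
qed

section \<open>Weighted composition operators\<close>

text \<open>
  The integral in the last condition is taken in \<open>[0, \<infinity>]\<close>, since \<^term>\<open>w\<close> itself need not be
  p-integrable.
\<close>

definition weighted_composition ::
  "'a measure \<Rightarrow> real \<Rightarrow> ('a \<Rightarrow> 'k::{real_normed_field, euclidean_space}) \<Rightarrow> ('a \<Rightarrow> 'a) \<Rightarrow> bool" where
  "weighted_composition M p w f \<longleftrightarrow>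
     w \<in> borel_measurable M \<and>
     (\<forall>\<phi>\<in>Lp_fun M p. (\<lambda>x. \<phi> x * w x) \<in> Lp_fun M p) \<and>
     f \<in> measurable M M \<and>
     (\<forall>B\<in>sets M. f ` B \<in> sets M) \<and>
     (\<exists>c::real. 0 < c \<and>
       (\<forall>B\<in>sets M. (\<integral>\<^sup>+x\<in>B. ennreal (norm (w x) powr p) \<partial>M) \<le> ennreal c * emeasure M (f ` B)))"

definition weighted_comp_op ::
  "'a measure \<Rightarrow> real \<Rightarrow> ('a \<Rightarrow> 'k::{real_normed_field, euclidean_space}) \<Rightarrow> ('a \<Rightarrow> 'a) \<Rightarrow>
    ('a \<Rightarrow> 'k) set \<Rightarrow> ('a \<Rightarrow> 'k) set" where
  "weighted_comp_op M p w f c = Lp_class M p (\<lambda>x. Lp_rep c (f x) * w x)"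

lemma weighted_composition_nn_integral_le:
  assumes "weighted_composition M p w f"
  obtains c :: real where "0 < c"
    "\<And>g. g \<in> borel_measurable M \<Longrightarrow>
      (\<integral>\<^sup>+x. ennreal (norm (w x) powr p) * g (f x) \<partial>M) \<le> ennreal c * (\<integral>\<^sup>+x. g x \<partial>M)"
proof -
  have w [measurable]: "w \<in> borel_measurable M" and f [measurable]: "f \<in> measurable M M"
    and fB: "\<And>B. B \<in> sets M \<Longrightarrow> f ` B \<in> sets M"
    using assms by (auto simp: weighted_composition_def)
  obtain c :: real where c: "0 < c"
    and le: "\<And>B. B \<in> sets M \<Longrightarrow>
      (\<integral>\<^sup>+x\<in>B. ennreal (norm (w x) powr p) \<partial>M) \<le> ennreal c * emeasure M (f ` B)"
    using assms by (auto simp: weighted_composition_def)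
  define D where "D = density M (\<lambda>x. ennreal (norm (w x) powr p))"
  define C where "C = density M (\<lambda>_. ennreal c)"
  have fD [measurable]: "f \<in> measurable D M"
    by (simp add: D_def)
  have distr_le: "distr D M f \<le> C"
  proof (rule le_measure[THEN iffD2])
    show "sets (distr D M f) = sets C"
      by (simp add: C_def)
    show "\<forall>A\<in>sets (distr D M f). emeasure (distr D M f) A \<le> emeasure C A"
    proof
      fix A assume "A \<in> sets (distr D M f)"
      then have A [measurable]: "A \<in> sets M" by simp
      have "emeasure (distr D M f) A = emeasure D (f -` A \<inter> space M)"
        by (simp add: emeasure_distr D_def)
      also have "\<dots> = (\<integral>\<^sup>+x\<in>f -` A \<inter> space M. ennreal (norm (w x) powr p) \<partial>M)"
        unfolding D_def by (rule emeasure_density) auto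
      also have "\<dots> \<le> ennreal c * emeasure M (f ` (f -` A \<inter> space M))"
        by (rule le) simp
      also have "\<dots> \<le> ennreal c * emeasure M A"
        by (intro mult_left_mono emeasure_mono) auto
      also have "\<dots> = emeasure C A"
        by (simp add: C_def emeasure_density_const)
      finally show "emeasure (distr D M f) A \<le> emeasure C A" .
    qed
  qed
  have "(\<integral>\<^sup>+x. ennreal (norm (w x) powr p) * g (f x) \<partial>M) \<le> ennreal c * (\<integral>\<^sup>+x. g x \<partial>M)"
    if g [measurable]: "g \<in> borel_measurable M" for g
  proof -
    have "(\<integral>\<^sup>+x. ennreal (norm (w x) powr p) * g (f x) \<partial>M) = (\<integral>\<^sup>+x. g (f x) \<partial>D)"
      unfolding D_def by (rule nn_integral_density[symmetric]) auto
    also have "\<dots> = (\<integral>\<^sup>+x. g x \<partial>distr D M f)"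
      by (rule nn_integral_distr[symmetric]) auto
    also have "\<dots> \<le> (\<integral>\<^sup>+x. g x \<partial>C)"
      by (rule nn_integral_mono_measure) (use distr_le in \<open>auto simp: C_def\<close>)
    also have "\<dots> = ennreal c * (\<integral>\<^sup>+x. g x \<partial>M)"
      unfolding C_def by (subst nn_integral_density) (auto simp: nn_integral_cmult)
    finally show ?thesis .
  qed
  then show thesis using that c by blast
qed

lemma weighted_composition_Lp_fun:
  assumes "weighted_composition M p w f" and \<phi>: "\<phi> \<in> Lp_fun M p"
  shows "(\<lambda>x. \<phi> (f x) * w x) \<in> Lp_fun M p"
proof -
  have [measurable]: "w \<in> borel_measurable M" "f \<in> measurable M M" "\<phi> \<in> borel_measurable M"
    using assms by (auto simp: weighted_composition_def Lp_fun_def)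
  obtain c :: real where
    c: "\<And>g. g \<in> borel_measurable M \<Longrightarrow>
      (\<integral>\<^sup>+x. ennreal (norm (w x) powr p) * g (f x) \<partial>M) \<le> ennreal c * (\<integral>\<^sup>+x. g x \<partial>M)"
    by (rule weighted_composition_nn_integral_le[OF assms(1)]) blast
  have fin: "(\<integral>\<^sup>+x. ennreal (norm (\<phi> x) powr p) \<partial>M) < \<infinity>"
    using \<phi> by (auto simp: Lp_fun_def integrable_iff_bounded)
  have "(\<integral>\<^sup>+x. ennreal (norm (\<phi> (f x) * w x) powr p) \<partial>M)
      = (\<integral>\<^sup>+x. ennreal (norm (w x) powr p) * ennreal (norm (\<phi> (f x)) powr p) \<partial>M)"
    by (intro nn_integral_cong) (simp add: norm_mult powr_mult ennreal_mult' mult.commute)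
  also have "\<dots> \<le> ennreal c * (\<integral>\<^sup>+x. ennreal (norm (\<phi> x) powr p) \<partial>M)"
    by (rule c) measurable
  also have "\<dots> < \<infinity>"
    using fin by (simp add: ennreal_mult_less_top)
  finally have "integrable M (\<lambda>x. norm (\<phi> (f x) * w x) powr p)"
    by (intro integrableI_nonneg) auto
  then show ?thesis by (simp add: Lp_fun_def)
qed

lemma weighted_composition_cong_AE:
  assumes "weighted_composition M p w f" "\<phi> \<in> Lp_fun M p" "\<psi> \<in> Lp_fun M p"
    and eq: "AE x in M. \<phi> x = \<psi> x"
  shows "AE x in M. \<phi> (f x) * w x = \<psi> (f x) * w x"
proof -
  have [measurable]: "w \<in> borel_measurable M" "f \<in> measurable M M"
      "\<phi> \<in> borel_measurable M" "\<psi> \<in> borel_measurable M"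
    using assms by (auto simp: weighted_composition_def Lp_fun_def)
  define g where "g x = (indicator {x. \<phi> x \<noteq> \<psi> x} x :: ennreal)" for x
  have [measurable]: "g \<in> borel_measurable M"
    unfolding g_def by measurable
  obtain c :: real where
    c: "(\<integral>\<^sup>+x. ennreal (norm (w x) powr p) * g (f x) \<partial>M) \<le> ennreal c * (\<integral>\<^sup>+x. g x \<partial>M)"
    by (rule weighted_composition_nn_integral_le[OF assms(1)]) (use \<open>g \<in> borel_measurable M\<close> in blast)
  have "AE x in M. g x = 0"
    using eq by eventually_elim (simp add: g_def)
  then have "(\<integral>\<^sup>+x. g x \<partial>M) = 0"
    by (subst nn_integral_0_iff_AE) auto
  then have "(\<integral>\<^sup>+x. ennreal (norm (w x) powr p) * g (f x) \<partial>M) = 0"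
    using c by simp
  then have "AE x in M. ennreal (norm (w x) powr p) * g (f x) = 0"
    by (subst (asm) nn_integral_0_iff_AE) auto
  then show ?thesis
    by eventually_elim (auto simp: g_def indicator_def split: if_splits)
qed

lemma weighted_comp_op_class:
  assumes "weighted_composition M p w f" "\<phi> \<in> Lp_fun M p"
  shows "weighted_comp_op M p w f (Lp_class M p \<phi>) = Lp_class M p (\<lambda>x. \<phi> (f x) * w x)"
proof -
  note rep = Lp_rep_class[OF assms(2)]
  show ?thesis
    unfolding weighted_comp_op_def
      Lp_class_eq_iff[OF weighted_composition_Lp_fun[OF assms(1) rep(1)]
        weighted_composition_Lp_fun[OF assms]]
    by (rule weighted_composition_cong_AE[OF assms(1) rep(1) assms(2) rep(2)])
qed

lemma weighted_comp_op_in_Lp: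
  assumes "weighted_composition M p w f" "c \<in> Lp M p"
  shows "weighted_comp_op M p w f c \<in> Lp M p"
proof -
  obtain \<phi> where \<phi>: "\<phi> \<in> Lp_fun M p" "c = Lp_class M p \<phi>"
    by (rule Lp_cases[OF assms(2)])
  show ?thesis
    unfolding \<phi>(2) weighted_comp_op_class[OF assms(1) \<phi>(1)]
    by (rule Lp_class_in_Lp[OF weighted_composition_Lp_fun[OF assms(1) \<phi>(1)]])
qed

definition iterated_weight :: "('a \<Rightarrow> 'k::real_normed_field) \<Rightarrow> ('a \<Rightarrow> 'a) \<Rightarrow> nat \<Rightarrow> 'a \<Rightarrow> 'k" where
  "iterated_weight w f n x = (\<Prod>k<n. w ((f ^^ k) x))"

definition iterated_measure ::
  "'a measure \<Rightarrow> real \<Rightarrow> ('a \<Rightarrow> 'k::real_normed_field) \<Rightarrow> ('a \<Rightarrow> 'a) \<Rightarrow> nat \<Rightarrow> 'a set \<Rightarrow> ennreal" where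
  "iterated_measure M p w f n B = (\<integral>\<^sup>+x\<in>B. ennreal (norm (iterated_weight w f n x) powr p) \<partial>M)"

definition iterated_preimage :: "'a measure \<Rightarrow> ('a \<Rightarrow> 'a) \<Rightarrow> nat \<Rightarrow> 'a set \<Rightarrow> 'a set" where
  "iterated_preimage M f n B = (f ^^ n) -` B \<inter> space M"

text \<open>Only meaningful for \<open>r > 0\<close>, where \<open>\<infinity>\<close> to the power \<open>r\<close> is \<open>\<infinity>\<close>.\<close>

definition ennreal_powr :: "ennreal \<Rightarrow> real \<Rightarrow> ennreal" where
  "ennreal_powr x r = (if x = \<infinity> then \<infinity> else ennreal (enn2real x powr r))"

section \<open>Mean Li--Yorke chaos\<close>

text \<open>The value at \<open>N = 0\<close> in the sequences below is irrelevant for the limits.\<close>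

definition (in Metric_space) mean_Li_Yorke_chaotic :: "('a \<Rightarrow> 'a) \<Rightarrow> bool" where
  "mean_Li_Yorke_chaotic g \<longleftrightarrow>
     (\<exists>S\<subseteq>M. uncountable S \<and>
       (\<forall>x\<in>S. \<forall>y\<in>S. x \<noteq> y \<longrightarrow>
          liminf (\<lambda>N. ereal ((\<Sum>n=1..N. d ((g ^^ n) x) ((g ^^ n) y)) / real N)) = 0 \<and>
          limsup (\<lambda>N. ereal ((\<Sum>n=1..N. d ((g ^^ n) x) ((g ^^ n) y)) / real N)) > 0))"

end

theory Submission
  imports Defs
begin

text \<open>
  The difference \<open>\<phi>\<close> of two points of a scrambled set has iterates \<open>T^k \<phi>\<close> whose norms \<open>a k\<close> have
  Cesaro means with lower limit 0 and positive upper limit.  The family consists of the dyadic level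
  sets \<open>{2^i \<le> |T^k \<phi>| < 2^(i+1)}\<close> of non-zero measure, for all integers \<open>i\<close> and all \<open>k \<ge> 0\<close>.  The
  characteristic function of such a set is at most \<open>2^(-i) |T^k \<phi>|\<close>, and so it inherits the lower limit.
  If the supremum were finite, then summing over the level sets of \<open>T^k \<phi>\<close> would give
  \<open>(1/N) \<Sum>n=1..N. a (n + k)^p \<le> D * a k^p\<close> with \<open>D\<close> independent of \<open>N\<close> and \<open>k\<close>; since \<open>a k\<close> can be
  chosen arbitrarily small, the upper limit of the Cesaro means of \<open>a\<close> would be 0.
\<close>

section \<open>Iterates of the operator on functions and on classes\<close>

definition weighted_iterate ::
  "('a \<Rightarrow> 'k::real_normed_field) \<Rightarrow> ('a \<Rightarrow> 'a) \<Rightarrow> nat \<Rightarrow> ('a \<Rightarrow> 'k) \<Rightarrow> 'a \<Rightarrow> 'k" where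
  "weighted_iterate w f n \<phi> x = \<phi> ((f ^^ n) x) * iterated_weight w f n x"

text \<open>Splitting off the factor with index 0 leaves a function composed with \<open>f\<close>,
  the shape to which the one-step integral estimate applies in inductions.\<close>

lemma iterated_weight_Suc:
  "iterated_weight w f (Suc n) x = w x * iterated_weight w f n (f x)"
  by (simp add: iterated_weight_def prod.lessThan_Suc_shift funpow_swap1 del: prod.lessThan_Suc)

text \<open>The cocycle identity of the weights; it turns \<open>weighted_iterate\<close> into a
  semigroup action in \<open>n\<close>.\<close>

lemma iterated_weight_add:
  "iterated_weight w f (n + k) x = iterated_weight w f n x * iterated_weight w f k ((f ^^ n) x)"
proof (induction n arbitrary: x)
  case 0
  then show ?case by (simp add: iterated_weight_def)
next
  case (Suc n)
  then show ?case by (simp add: iterated_weight_Suc mult.assoc funpow_swap1)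
qed

lemma weighted_iterate_add:
  "weighted_iterate w f n (weighted_iterate w f k \<phi>) = weighted_iterate w f (n + k) \<phi>"
proof (rule ext)
  fix x
  have "(f ^^ k) ((f ^^ n) x) = (f ^^ (n + k)) x"
    by (subst add.commute) (simp add: funpow_add)
  then show "weighted_iterate w f n (weighted_iterate w f k \<phi>) x = weighted_iterate w f (n + k) \<phi> x"
    by (simp add: weighted_iterate_def iterated_weight_add mult_ac)
qed

lemma weighted_iterate_Suc:
  "weighted_iterate w f (Suc n) \<phi> = (\<lambda>x. weighted_iterate w f n \<phi> (f x) * w x)"
  by (rule ext) (simp add: weighted_iterate_def iterated_weight_Suc funpow_swap1 mult_ac)

lemma weighted_iterate_diff:
  "weighted_iterate w f n (\<lambda>x. \<phi> x - \<psi> x)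
    = (\<lambda>x. weighted_iterate w f n \<phi> x - weighted_iterate w f n \<psi> x)"
  by (rule ext) (simp add: weighted_iterate_def algebra_simps)

lemma measurable_iterates:
  fixes w :: "'a \<Rightarrow> 'k::{real_normed_field, euclidean_space}"
  assumes "weighted_composition M p w f"
  shows "(f ^^ n) \<in> measurable M M" "iterated_weight w f n \<in> borel_measurable M"
proof -
  have [measurable]: "w \<in> borel_measurable M" "f \<in> measurable M M"
    using assms by (auto simp: weighted_composition_def)
  show 1: "(f ^^ n) \<in> measurable M M" for n
    by (induction n) (auto intro: measurable_comp[OF _ \<open>f \<in> measurable M M\<close>] simp: id_def)
  show "iterated_weight w f n \<in> borel_measurable M"
    unfolding iterated_weight_def
    by (intro borel_measurable_prod measurable_compose[OF 1] \<open>w \<in> borel_measurable M\<close>)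
qed

text \<open>In measure terms, the image of \<mu>_n under f^n is bounded by a constant multiple of
  \<mu>. The induction applies the one-step estimate to the whole integrand of stage
  \<open>n\<close>, so the constants multiply.\<close>

lemma iterated_nn_integral_le:
  fixes w :: "'a \<Rightarrow> 'k::{real_normed_field, euclidean_space}"
  assumes wc: "weighted_composition M p w f"
  obtains c :: real where "\<And>g. g \<in> borel_measurable M \<Longrightarrow>
    (\<integral>\<^sup>+x. ennreal (norm (iterated_weight w f n x) powr p) * g ((f ^^ n) x) \<partial>M)
      \<le> ennreal c * (\<integral>\<^sup>+x. g x \<partial>M)"
proof (induction n arbitrary: thesis)
  case 0
  show ?case by (rule 0[of 1]) (simp add: iterated_weight_def)
next
  case (Suc n)
  obtain c :: real where c: "\<And>g. g \<in> borel_measurable M \<Longrightarrow>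
    (\<integral>\<^sup>+x. ennreal (norm (iterated_weight w f n x) powr p) * g ((f ^^ n) x) \<partial>M)
      \<le> ennreal c * (\<integral>\<^sup>+x. g x \<partial>M)"
    by (rule Suc.IH) blast
  obtain d :: real where d: "0 < d" "\<And>g. g \<in> borel_measurable M \<Longrightarrow>
      (\<integral>\<^sup>+x. ennreal (norm (w x) powr p) * g (f x) \<partial>M) \<le> ennreal d * (\<integral>\<^sup>+x. g x \<partial>M)"
    by (rule weighted_composition_nn_integral_le[OF wc]) blast
  note [measurable] = measurable_iterates[OF wc]
  show ?case
  \<comment> \<open>The sign of \<open>c\<close> is unknown here; positivity of \<open>d\<close>
    alone suffices to split \<open>ennreal (d * c)\<close>.\<close>
  proof (rule Suc.prems[of "d * c"])
    fix g :: "'a \<Rightarrow> ennreal" assume [measurable]: "g \<in> borel_measurable M"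
    let ?h = "\<lambda>x. ennreal (norm (iterated_weight w f n x) powr p) * g ((f ^^ n) x)"
    have "(\<integral>\<^sup>+x. ennreal (norm (iterated_weight w f (Suc n) x) powr p) * g ((f ^^ Suc n) x) \<partial>M)
       = (\<integral>\<^sup>+x. ennreal (norm (w x) powr p) * ?h (f x) \<partial>M)"
      by (intro nn_integral_cong)
        (simp add: iterated_weight_Suc norm_mult powr_mult ennreal_mult' mult.assoc funpow_swap1)
    also have "\<dots> \<le> ennreal d * (\<integral>\<^sup>+x. ?h x \<partial>M)"
      by (rule d(2)) measurable
    also have "\<dots> \<le> ennreal d * (ennreal c * (\<integral>\<^sup>+x. g x \<partial>M))"
      by (intro mult_left_mono c) auto
    finally show "(\<integral>\<^sup>+x. ennreal (norm (iterated_weight w f (Suc n) x) powr p) * g ((f ^^ Suc n) x) \<partial>M)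
       \<le> ennreal (d * c) * (\<integral>\<^sup>+x. g x \<partial>M)"
      using d(1) by (simp add: ennreal_mult' mult.assoc)
  qed
qed

lemma weighted_iterate_Lp_fun:
  assumes "weighted_composition M p w f" "\<phi> \<in> Lp_fun M p"
  shows "weighted_iterate w f n \<phi> \<in> Lp_fun M p"
proof (induction n)
  case 0
  then show ?case using assms by (simp add: weighted_iterate_def iterated_weight_def Lp_fun_def)
next
  case (Suc n)
  then show ?case
    unfolding weighted_iterate_Suc by (rule weighted_composition_Lp_fun[OF assms(1)])
qed

text \<open>Replaces iterates on classes, which choose a representative at each step, by an explicit
  function.\<close>

lemma weighted_comp_op_funpow_class:
  assumes "weighted_composition M p w f" "\<phi> \<in> Lp_fun M p"
  shows "(weighted_comp_op M p w f ^^ n) (Lp_class M p \<phi>) = Lp_class M p (weighted_iterate w f n \<phi>)"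
proof (induction n)
  case 0
  then show ?case by (simp add: weighted_iterate_def[abs_def] iterated_weight_def)
next
  case (Suc n)
  then show ?case
    by (simp add: weighted_comp_op_class[OF assms(1) weighted_iterate_Lp_fun[OF assms]]
      weighted_iterate_Suc)
qed

lemma Lp_dist_weighted_comp_op_funpow:
  assumes "weighted_composition M p w f" "\<phi> \<in> Lp_fun M p" "\<psi> \<in> Lp_fun M p"
  shows "Lp_dist M p ((weighted_comp_op M p w f ^^ n) (Lp_class M p \<phi>))
      ((weighted_comp_op M p w f ^^ n) (Lp_class M p \<psi>))
    = Lp_norm M p (weighted_iterate w f n (\<lambda>x. \<phi> x - \<psi> x))"
  using assms
  by (simp add: weighted_comp_op_funpow_class Lp_dist_class weighted_iterate_Lp_fun
    weighted_iterate_diff)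

lemma nn_integral_eq_Lp_norm_powr:
  assumes "1 \<le> p" "\<phi> \<in> Lp_fun M p"
  shows "(\<integral>\<^sup>+x. ennreal (norm (\<phi> x) powr p) \<partial>M) = ennreal (Lp_norm M p \<phi> powr p)"
  using assms by (subst Lp_norm_powr, simp, subst nn_integral_eq_integral) (auto simp: Lp_fun_def)

text \<open>The preimage becomes an indicator composed with f^n, so that \<mu>_n(f^{-n}(B)) fits
  \<open>iterated_nn_integral_le\<close> and depends linearly on the indicator of
  \<open>B\<close>.\<close>

lemma iterated_measure_preimage:
  "iterated_measure M p w f n (iterated_preimage M f n B)
    = (\<integral>\<^sup>+x. ennreal (norm (iterated_weight w f n x) powr p) * indicator B ((f ^^ n) x) \<partial>M)"
  unfolding iterated_measure_def iterated_preimage_def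
  by (intro nn_integral_cong) (auto simp: indicator_def)

text \<open>Null level sets are left out of the family; this lemma shows that they contribute
  nothing to the norms of the iterates either.\<close>

lemma iterated_measure_preimage_null:
  fixes w :: "'a \<Rightarrow> 'k::{real_normed_field, euclidean_space}"
  assumes "weighted_composition M p w f" "B \<in> sets M" "emeasure M B = 0"
  shows "iterated_measure M p w f n (iterated_preimage M f n B) = 0"
proof -
  obtain c :: real where "\<And>g. g \<in> borel_measurable M \<Longrightarrow>
    (\<integral>\<^sup>+x. ennreal (norm (iterated_weight w f n x) powr p) * g ((f ^^ n) x) \<partial>M)
      \<le> ennreal c * (\<integral>\<^sup>+x. g x \<partial>M)"
    by (rule iterated_nn_integral_le[OF assms(1)]) blast
  from this[of "indicator B"] show ?thesis
    using assms by (simp add: iterated_measure_preimage)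
qed

subsection \<open>Dyadic level sets\<close>

text \<open>The half-open bounds make the levels disjoint, and together they cover exactly the
  points of the space where \<psi> does not vanish.\<close>

definition dyadic_level :: "'a measure \<Rightarrow> ('a \<Rightarrow> 'k::real_normed_vector) \<Rightarrow> int \<Rightarrow> 'a set" where
  "dyadic_level M \<psi> i = {x \<in> space M. 2 powr i \<le> norm (\<psi> x) \<and> norm (\<psi> x) < 2 powr (i + 1)}"

lemma dyadic_level_sets:
  fixes \<psi> :: "'a \<Rightarrow> 'k::{real_normed_field, euclidean_space}"
  assumes [measurable]: "\<psi> \<in> borel_measurable M"
  shows "dyadic_level M \<psi> i \<in> sets M"
  unfolding dyadic_level_def by measurable

lemma dyadic_level_unique:
  assumes "x \<in> dyadic_level M \<psi> i" "x \<in> dyadic_level M \<psi> j"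
  shows "i = j"
proof -
  have "2 powr real_of_int i < 2 powr (real_of_int j + 1)" "2 powr real_of_int j < 2 powr (real_of_int i + 1)"
    using assms unfolding dyadic_level_def by (auto simp del: powr_less_cancel_iff)
  then show ?thesis
    by (simp add: powr_less_cancel_iff)
qed

lemma dyadic_level_exists:
  assumes "x \<in> space M" "\<psi> x \<noteq> 0"
  shows "x \<in> dyadic_level M \<psi> \<lfloor>log 2 (norm (\<psi> x))\<rfloor>"
proof -
  let ?r = "norm (\<psi> x)"
  have "2 powr \<lfloor>log 2 ?r\<rfloor> \<le> 2 powr log 2 ?r" "2 powr log 2 ?r < 2 powr (\<lfloor>log 2 ?r\<rfloor> + 1)"
    by (auto simp: powr_less_cancel_iff)
  then show ?thesis
    using assms by (simp add: dyadic_level_def)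
qed

text \<open>The p-th power of |\<psi>| rounded down to a power of 2, and 0 where \<psi> vanishes.
  Enumerating the integers by \<open>int_decode\<close> gives a series over the naturals, which can
  be integrated term by term.\<close>

definition dyadic_step :: "'a measure \<Rightarrow> real \<Rightarrow> ('a \<Rightarrow> 'k::real_normed_vector) \<Rightarrow> 'a \<Rightarrow> ennreal" where
  "dyadic_step M p \<psi> x =
    (\<Sum>j. ennreal ((2 powr int_decode j) powr p) * indicator (dyadic_level M \<psi> (int_decode j)) x)"

lemma dyadic_step_on_level:
  assumes "x \<in> dyadic_level M \<psi> i"
  shows "dyadic_step M p \<psi> x = ennreal ((2 powr i) powr p)"
proof -
  have "dyadic_step M p \<psi> x = (\<Sum>j\<in>{int_encode i}.
    ennreal ((2 powr int_decode j) powr p) * indicator (dyadic_level M \<psi> (int_decode j)) x)"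
    unfolding dyadic_step_def
  proof (rule suminf_finite)
    fix j assume "j \<notin> {int_encode i}"
    then have "int_decode j \<noteq> i" by auto
    then show "ennreal ((2 powr int_decode j) powr p) *
        indicator (dyadic_level M \<psi> (int_decode j)) x = (0::ennreal)"
      using dyadic_level_unique[OF assms, of "int_decode j"] by (auto simp: indicator_def)
  qed simp
  then show ?thesis
    using assms by simp
qed

lemma dyadic_step_le:
  assumes "1 \<le> p" "x \<in> space M"
  shows "dyadic_step M p \<psi> x \<le> ennreal (norm (\<psi> x) powr p)"
proof (cases "\<psi> x = 0")
  case True
  then have "x \<notin> dyadic_level M \<psi> i" for i
    by (simp add: dyadic_level_def)
  then show ?thesis
    by (simp add: dyadic_step_def)
next
  case False
  note l = dyadic_level_exists[OF assms(2), of \<psi>, OF False]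
  show ?thesis
    unfolding dyadic_step_on_level[OF l] using l assms(1)
    by (intro ennreal_leI powr_mono2) (auto simp: dyadic_level_def)
qed

text \<open>Rounding down loses a factor of at most 2, hence at most 2^p after taking p-th
  powers.\<close>

lemma dyadic_step_ge:
  assumes "1 \<le> p" "x \<in> space M"
  shows "ennreal (norm (\<psi> x) powr p) \<le> ennreal (2 powr p) * dyadic_step M p \<psi> x"
proof (cases "\<psi> x = 0")
  case False
  define i where "i = \<lfloor>log 2 (norm (\<psi> x))\<rfloor>"
  have l: "x \<in> dyadic_level M \<psi> i"
    unfolding i_def by (rule dyadic_level_exists[OF assms(2), of \<psi>, OF False])
  have "norm (\<psi> x) \<le> 2 * 2 powr i"
    using l by (auto simp: dyadic_level_def powr_add)
  then have "norm (\<psi> x) powr p \<le> (2 * 2 powr i) powr p"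
    using assms by (intro powr_mono2) auto
  also have "\<dots> = 2 powr p * (2 powr i) powr p"
    by (simp add: powr_mult)
  finally show ?thesis
    unfolding dyadic_step_on_level[OF l] by (simp flip: ennreal_mult)
qed simp

lemma nn_integral_dyadic_step:
  fixes \<psi> :: "'a \<Rightarrow> 'k::{real_normed_field, euclidean_space}"
  assumes [measurable]: "\<psi> \<in> borel_measurable M"
  shows "(\<integral>\<^sup>+x. dyadic_step M p \<psi> x \<partial>M)
    = (\<Sum>j. ennreal ((2 powr int_decode j) powr p) * emeasure M (dyadic_level M \<psi> (int_decode j)))"
proof -
  note [measurable] = dyadic_level_sets[OF assms]
  show ?thesis
    unfolding dyadic_step_def
    by (subst nn_integral_suminf) (auto simp: nn_integral_cmult_indicator)
qed

lemma nn_integral_dyadic_step_iterate: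
  fixes \<psi> :: "'a \<Rightarrow> 'k::{real_normed_field, euclidean_space}"
  assumes wc: "weighted_composition M p w f" and [measurable]: "\<psi> \<in> borel_measurable M"
  shows "(\<integral>\<^sup>+x. ennreal (norm (iterated_weight w f n x) powr p) * dyadic_step M p \<psi> ((f ^^ n) x) \<partial>M)
    = (\<Sum>j. ennreal ((2 powr int_decode j) powr p) *
        iterated_measure M p w f n (iterated_preimage M f n (dyadic_level M \<psi> (int_decode j))))"
proof -
  note [measurable] = dyadic_level_sets[OF \<open>\<psi> \<in> borel_measurable M\<close>] measurable_iterates[OF wc]
  have "(\<integral>\<^sup>+x. ennreal (norm (iterated_weight w f n x) powr p) * dyadic_step M p \<psi> ((f ^^ n) x) \<partial>M)
    = (\<integral>\<^sup>+x. (\<Sum>j. ennreal ((2 powr int_decode j) powr p) *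
        (ennreal (norm (iterated_weight w f n x) powr p) *
          indicator (dyadic_level M \<psi> (int_decode j)) ((f ^^ n) x))) \<partial>M)"
    unfolding dyadic_step_def by (simp add: mult_ac flip: ennreal_suminf_cmult)
  also have "\<dots> = (\<Sum>j. \<integral>\<^sup>+x. ennreal ((2 powr int_decode j) powr p) *
        (ennreal (norm (iterated_weight w f n x) powr p) *
          indicator (dyadic_level M \<psi> (int_decode j)) ((f ^^ n) x)) \<partial>M)"
    by (rule nn_integral_suminf) measurable
  also have "\<dots> = (\<Sum>j. ennreal ((2 powr int_decode j) powr p) *
        iterated_measure M p w f n (iterated_preimage M f n (dyadic_level M \<psi> (int_decode j))))"
    unfolding iterated_measure_preimage by (subst nn_integral_cmult) auto
  finally show ?thesis .
qed

section \<open>Estimates for the level sets of a p-integrable function\<close>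

lemma emeasure_dyadic_level_finite:
  fixes \<psi> :: "'a \<Rightarrow> 'k::{real_normed_field, euclidean_space}"
  assumes p: "1 \<le> p" and \<psi>: "\<psi> \<in> Lp_fun M p"
  shows "emeasure M (dyadic_level M \<psi> i) < \<infinity>"
proof -
  let ?c = "ennreal ((2 powr i) powr p)" and ?L = "dyadic_level M \<psi> i"
  have [measurable]: "\<psi> \<in> borel_measurable M"
    using \<psi> by (simp add: Lp_fun_def)
  note [measurable] = dyadic_level_sets[OF \<open>\<psi> \<in> borel_measurable M\<close>]
  \<comment> \<open>Markov's inequality: |\<psi>|^p is at least \<open>?c\<close> on the level
    set.\<close>
  have "?c * emeasure M ?L = (\<integral>\<^sup>+x. ?c * indicator ?L x \<partial>M)"
    by (simp add: nn_integral_cmult_indicator)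
  also have "\<dots> \<le> (\<integral>\<^sup>+x. ennreal (norm (\<psi> x) powr p) \<partial>M)"
    using p by (intro nn_integral_mono)
      (auto simp: indicator_def dyadic_level_def intro!: ennreal_leI powr_mono2)
  also have "\<dots> < \<infinity>"
    by (simp add: nn_integral_eq_Lp_norm_powr[OF p \<psi>])
  finally have "?c * emeasure M ?L < \<infinity>" .
  then show ?thesis
    by (auto simp: ennreal_mult_less_top)
qed

text \<open>On the preimage of the level under f^n, 2^i times the modulus of the iterated weight is
  at most the modulus of the n-th iterate of \<psi>. Integrate p-th powers and take p-th
  roots.\<close>

lemma iterated_measure_dyadic_level_le:
  fixes \<psi> :: "'a \<Rightarrow> 'k::{real_normed_field, euclidean_space}"
  assumes p: "1 \<le> p" and wc: "weighted_composition M p w f" and \<psi>: "\<psi> \<in> Lp_fun M p"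
  shows "ennreal_powr (iterated_measure M p w f n (iterated_preimage M f n (dyadic_level M \<psi> i))) (1 / p)
    \<le> ennreal (Lp_norm M p (weighted_iterate w f n \<psi>) / 2 powr i)"
proof -
  let ?m = "iterated_measure M p w f n (iterated_preimage M f n (dyadic_level M \<psi> i))"
  let ?c = "(2 powr i) powr p" and ?a = "Lp_norm M p (weighted_iterate w f n \<psi>)"
  note [measurable] = measurable_iterates[OF wc]
  have [measurable]: "\<psi> \<in> borel_measurable M"
    using \<psi> by (simp add: Lp_fun_def)
  note [measurable] = dyadic_level_sets[OF \<open>\<psi> \<in> borel_measurable M\<close>]
  have a: "0 \<le> ?a" by (simp add: Lp_norm_def)
  have "ennreal ?c * ?m = (\<integral>\<^sup>+x. ennreal ?c * (ennreal (norm (iterated_weight w f n x) powr p) *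
      indicator (dyadic_level M \<psi> i) ((f ^^ n) x)) \<partial>M)"
    unfolding iterated_measure_preimage by (subst nn_integral_cmult) auto
  also have "\<dots> \<le> (\<integral>\<^sup>+x. ennreal (norm (weighted_iterate w f n \<psi> x) powr p) \<partial>M)"
    using p by (intro nn_integral_mono)
      (auto simp: indicator_def dyadic_level_def weighted_iterate_def norm_mult powr_mult
        simp flip: ennreal_mult intro!: ennreal_leI mult_right_mono powr_mono2)
  also have "\<dots> = ennreal (?a powr p)"
    by (rule nn_integral_eq_Lp_norm_powr[OF p weighted_iterate_Lp_fun[OF wc \<psi>]])
  finally have le: "ennreal ?c * ?m \<le> ennreal (?a powr p)" .
  \<comment> \<open>Finiteness comes first, so that \<open>ennreal_powr\<close> is evaluated in its
    real branch.\<close>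
  then have "ennreal ?c * ?m < \<infinity>"
    by (rule le_less_trans) simp
  then have "?m < \<infinity>"
    by (auto simp: ennreal_mult_less_top)
  then obtain m where m: "?m = ennreal m" "0 \<le> m"
    by (cases ?m) auto
  have "?c * m \<le> ?a powr p"
    using le m by (simp flip: ennreal_mult)
  then have "m \<le> (?a / 2 powr i) powr p"
    using a by (simp add: powr_divide field_simps)
  then have "m powr (1 / p) \<le> ((?a / 2 powr i) powr p) powr (1 / p)"
    using p m by (intro powr_mono2) auto
  also have "\<dots> = ?a / 2 powr i"
    using p a by (simp add: powr_powr)
  finally show ?thesis
    using m by (simp add: ennreal_powr_def ennreal_leI)
qed

text \<open>The bound assumed for each level extends by linearity to \<open>dyadic_step\<close>.
  Passing from |\<psi>|^p to the step function under the iterates costs 2^p; passing back on the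
  right costs nothing.\<close>

lemma sum_Lp_norm_iterates_le:
  fixes \<psi> :: "'a \<Rightarrow> 'k::{real_normed_field, euclidean_space}"
  assumes p: "1 \<le> p" and wc: "weighted_composition M p w f" and \<psi>: "\<psi> \<in> Lp_fun M p"
    and C: "0 \<le> C"
    and le: "\<And>i. (\<Sum>n\<in>A. iterated_measure M p w f n (iterated_preimage M f n (dyadic_level M \<psi> i)))
      \<le> ennreal C * emeasure M (dyadic_level M \<psi> i)"
  shows "(\<Sum>n\<in>A. Lp_norm M p (weighted_iterate w f n \<psi>) powr p) \<le> 2 powr p * C * Lp_norm M p \<psi> powr p"
proof -
  note mi [measurable] = measurable_iterates[OF wc]
  have \<psi>m [measurable]: "\<psi> \<in> borel_measurable M"
    using \<psi> by (simp add: Lp_fun_def)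
  note [measurable] = dyadic_level_sets[OF \<psi>m]
  have [measurable]: "dyadic_step M p \<psi> \<in> borel_measurable M"
    unfolding dyadic_step_def by measurable
  let ?W = "\<lambda>n x. ennreal (norm (iterated_weight w f n x) powr p)"
  let ?d = "\<lambda>j. ennreal ((2 powr int_decode j) powr p)"
  let ?L = "\<lambda>j. dyadic_level M \<psi> (int_decode j)"
  let ?m = "\<lambda>n j. iterated_measure M p w f n (iterated_preimage M f n (?L j))"
  have 1: "ennreal (Lp_norm M p (weighted_iterate w f n \<psi>) powr p)
      \<le> ennreal (2 powr p) * (\<Sum>j. ?d j * ?m n j)" for n
  proof -
    have "ennreal (Lp_norm M p (weighted_iterate w f n \<psi>) powr p)
      = (\<integral>\<^sup>+x. ennreal (norm (weighted_iterate w f n \<psi> x) powr p) \<partial>M)"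
      by (rule nn_integral_eq_Lp_norm_powr[OF p weighted_iterate_Lp_fun[OF wc \<psi>], symmetric])
    also have "\<dots> = (\<integral>\<^sup>+x. ?W n x * ennreal (norm (\<psi> ((f ^^ n) x)) powr p) \<partial>M)"
      by (intro nn_integral_cong)
        (simp add: weighted_iterate_def norm_mult powr_mult mult.commute flip: ennreal_mult)
    also have "\<dots> \<le> (\<integral>\<^sup>+x. ennreal (2 powr p) * (?W n x * dyadic_step M p \<psi> ((f ^^ n) x)) \<partial>M)"
    \<comment> \<open>The comparison with the step function holds on the space only, hence the check
      that f^n maps the space into itself.\<close>
    proof (rule nn_integral_mono)
      fix x assume "x \<in> space M"
      then have "(f ^^ n) x \<in> space M"
        by (rule measurable_space[OF mi(1)])
      from mult_left_mono[OF dyadic_step_ge[OF p this, of \<psi>], of "?W n x"]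
      show "?W n x * ennreal (norm (\<psi> ((f ^^ n) x)) powr p)
          \<le> ennreal (2 powr p) * (?W n x * dyadic_step M p \<psi> ((f ^^ n) x))"
        by (simp add: mult_ac)
    qed
    also have "\<dots> = ennreal (2 powr p) * (\<integral>\<^sup>+x. ?W n x * dyadic_step M p \<psi> ((f ^^ n) x) \<partial>M)"
      by (rule nn_integral_cmult) measurable
    finally show ?thesis
      unfolding nn_integral_dyadic_step_iterate[OF wc \<psi>m] .
  qed
  have "ennreal (\<Sum>n\<in>A. Lp_norm M p (weighted_iterate w f n \<psi>) powr p)
    = (\<Sum>n\<in>A. ennreal (Lp_norm M p (weighted_iterate w f n \<psi>) powr p))"
    by (rule sum_ennreal[symmetric]) simp
  also have "\<dots> \<le> (\<Sum>n\<in>A. ennreal (2 powr p) * (\<Sum>j. ?d j * ?m n j))"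
    by (intro sum_mono 1)
  also have "\<dots> = ennreal (2 powr p) * (\<Sum>j. ?d j * (\<Sum>n\<in>A. ?m n j))"
    by (simp add: sum_distrib_left suminf_sum summableI)
  also have "\<dots> \<le> ennreal (2 powr p) * (\<Sum>j. ennreal C * (?d j * emeasure M (?L j)))"
  proof (intro mult_left_mono suminf_le summableI)
    show "?d j * (\<Sum>n\<in>A. ?m n j) \<le> ennreal C * (?d j * emeasure M (?L j))" for j
      using mult_left_mono[OF le, of "?d j"] by (simp add: mult_ac)
  qed simp
  also have "\<dots> = ennreal (2 powr p) * (ennreal C * (\<integral>\<^sup>+x. dyadic_step M p \<psi> x \<partial>M))"
    by (simp add: nn_integral_dyadic_step)
  also have "\<dots> \<le> ennreal (2 powr p) * (ennreal C * (\<integral>\<^sup>+x. ennreal (norm (\<psi> x) powr p) \<partial>M))"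
    using p by (intro mult_left_mono nn_integral_mono dyadic_step_le) auto
  also have "\<dots> = ennreal (2 powr p * C * Lp_norm M p \<psi> powr p)"
    unfolding nn_integral_eq_Lp_norm_powr[OF p \<psi>] using C by (simp add: mult.assoc flip: ennreal_mult)
  finally show ?thesis
    using C by (simp add: ennreal_le_iff)
qed

subsection \<open>Cesaro means\<close>

lemma sum_shift_le:
  fixes a :: "nat \<Rightarrow> real"
  assumes "\<And>n. 0 \<le> a n"
  shows "(\<Sum>n=1..N. a (n + k)) \<le> (\<Sum>n=1..N + k. a n)"
proof -
  have "(\<Sum>n=1..N. a (n + k)) = (\<Sum>n=1 + k..N + k. a n)"
    by (rule sum.shift_bounds_cl_nat_ivl[symmetric])
  also have "\<dots> \<le> (\<Sum>n=1..N + k. a n)"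
    using assms by (intro sum_mono2) auto
  finally show ?thesis .
qed

text \<open>The first N - k shifted terms are among the first N original ones, and the change of
  denominator costs at most a factor 2 once N is at least 2k.\<close>

lemma frequently_Cesaro_shift_less:
  fixes a :: "nat \<Rightarrow> real"
  assumes a: "\<And>n. 0 \<le> a n"
    and freq: "\<And>e. 0 < e \<Longrightarrow> \<exists>\<^sub>F N in sequentially. (\<Sum>n=1..N. a n) / N < e"
    and e: "0 < e"
  shows "\<exists>\<^sub>F N in sequentially. (\<Sum>n=1..N. a (n + k)) / N < e"
  unfolding frequently_sequentially
proof
  fix N0 :: nat
  \<comment> \<open>This size makes N - k positive and at least \<open>N0\<close>, and gives N \<le>
    2 (N - k), which the bound e/2 compensates.\<close>
  obtain N where N: "N \<ge> N0 + 2 * k + 1" "(\<Sum>n=1..N. a n) / N < e / 2"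
    using freq[of "e / 2"] e unfolding frequently_sequentially by (meson half_gt_zero)
  have "(\<Sum>n=1..N - k. a (n + k)) \<le> (\<Sum>n=1..N. a n)"
    using sum_shift_le[of a k "N - k", OF a] N by simp
  also have "\<dots> < e / 2 * N"
    using N by (simp add: field_simps)
  also have "\<dots> \<le> e * real (N - k)"
  proof -
    have "N \<le> 2 * real (N - k)" using N by linarith
    from mult_left_mono[OF this, of e] e show ?thesis by simp
  qed
  finally have "(\<Sum>n=1..N - k. a (n + k)) / real (N - k) < e"
    using N by (simp add: field_simps)
  then show "\<exists>n\<ge>N0. (\<Sum>i=1..n. a (i + k)) / real n < e"
    using N by (intro exI[of _ "N - k"]) auto
qed

text \<open>Takes the place of the power mean inequality: bounds on means of p-th powers become
  bounds on means. A term above \<delta> is absorbed by its p-th power.\<close>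

lemma le_add_powr:
  fixes a \<delta> p :: real
  assumes "1 \<le> p" "0 < \<delta>" "0 \<le> a"
  shows "a \<le> \<delta> + a powr p / \<delta> powr (p - 1)"
proof (cases "a \<le> \<delta>")
  case True
  then show ?thesis by (simp add: add_increasing2)
next
  case False
  then have "a * \<delta> powr (p - 1) \<le> a * a powr (p - 1)"
    using assms by (intro mult_left_mono powr_mono2) auto
  also have "\<dots> = a powr p"
    using assms False by (simp add: powr_mult_base)
  finally have "a \<le> a powr p / \<delta> powr (p - 1)"
    using assms by (simp add: field_simps)
  then show ?thesis using assms by simp
qed

text \<open>Start at an index k with a k < \<delta>: the p-th powers after it have means at most D
  \<delta>^p, so by \<open>le_add_powr\<close> the terms have means at most (1 + D) \<delta>. The
  first k terms are negligible for large N.\<close>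

lemma Cesaro_eventually_le:
  fixes a :: "nat \<Rightarrow> real"
  assumes p: "1 \<le> p" and a: "\<And>n. 0 \<le> a n" and D: "0 \<le> D"
    and small: "\<And>e. 0 < e \<Longrightarrow> \<exists>k. a k < e"
    and bound: "\<And>k N. (\<Sum>n=1..N. a (n + k) powr p) \<le> D * N * a k powr p"
    and e: "0 < e"
  shows "\<forall>\<^sub>F N in sequentially. (\<Sum>n=1..N. a n) / N \<le> e"
proof -
  \<comment> \<open>Chosen so that the tail uses up e/2; the other half is kept for the initial sum
    \<open>K\<close>.\<close>
  define \<delta> where "\<delta> = e / (2 * (1 + D))"
  have \<delta>: "0 < \<delta>" "(1 + D) * \<delta> = e / 2"
    using e D by (auto simp: \<delta>_def field_simps)
  obtain k where k: "a k < \<delta>" using small \<delta> by blast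
  have tail: "(\<Sum>n=1..N. a (n + k)) \<le> e / 2 * N" for N
  proof -
    have "(\<Sum>n=1..N. a (n + k)) \<le> (\<Sum>n=1..N. \<delta> + a (n + k) powr p / \<delta> powr (p - 1))"
      by (intro sum_mono le_add_powr p a \<delta>)
    also have "\<dots> = N * \<delta> + (\<Sum>n=1..N. a (n + k) powr p) / \<delta> powr (p - 1)"
      by (simp add: sum.distrib sum_divide_distrib)
    also have "\<dots> \<le> N * \<delta> + D * N * \<delta> powr p / \<delta> powr (p - 1)"
    proof (intro add_left_mono divide_right_mono order_trans[OF bound])
      show "D * N * a k powr p \<le> D * N * \<delta> powr p"
        using k a D p by (intro mult_left_mono powr_mono2) auto
    qed simp
    also have "\<dots> = (1 + D) * \<delta> * N"
      using \<delta> by (simp add: powr_diff field_simps)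
    finally show ?thesis by (simp add: \<delta>)
  qed
  define K where "K = (\<Sum>n=1..k. a n)"
  \<comment> \<open>From \<open>N0\<close> on, \<open>K\<close> is at most e/2 times N.\<close>
  obtain N0 :: nat where N0: "2 * K / e \<le> N0" using real_arch_simple by blast
  show ?thesis
    unfolding eventually_sequentially
  proof (intro exI allI impI)
    fix N assume N: "N \<ge> Suc (max N0 k)"
    have "(\<Sum>n=1..N. a n) = K + (\<Sum>n=1 + k..(N - k) + k. a n)"
      unfolding K_def using N sum.ub_add_nat[of 1 k a "N - k"] by (simp add: add.commute)
    also have "(\<Sum>n=1 + k..(N - k) + k. a n) = (\<Sum>n=1..N - k. a (n + k))"
      by (rule sum.shift_bounds_cl_nat_ivl)
    also have "K + \<dots> \<le> e / 2 * N + e / 2 * N"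
    proof (rule add_mono)
      have "2 * K / e \<le> N" using N0 N by linarith
      then show "K \<le> e / 2 * N" using e by (simp add: field_simps)
      show "(\<Sum>n=1..N - k. a (n + k)) \<le> e / 2 * N"
        using e by (intro order_trans[OF tail] mult_left_mono) auto
    qed
    finally show "(\<Sum>n=1..N. a n) / N \<le> e"
      using N by (simp add: field_simps)
  qed
qed

section \<open>Lower limits expressed by frequently small values\<close>

lemma frequently_less_of_liminf:
  fixes u :: "nat \<Rightarrow> real"
  assumes "liminf (\<lambda>N. ereal (u N)) = 0" "0 < e"
  shows "\<exists>\<^sub>F N in sequentially. u N < e"
proof (rule ccontr)
  assume "\<not> ?thesis"
  then have "\<forall>\<^sub>F N in sequentially. ereal e \<le> ereal (u N)"
    by (simp add: not_frequently not_less)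
  then have "ereal e \<le> liminf (\<lambda>N. ereal (u N))"
    by (rule Liminf_bounded)
  then show False using assms by simp
qed

text \<open>A value strictly between 0 and the lower limit would be eventually exceeded by
  \<open>s\<close>, yet frequently not reached.\<close>

lemma liminf_ennreal_eq_0:
  fixes s :: "nat \<Rightarrow> ennreal"
  assumes "\<And>e. 0 < e \<Longrightarrow> \<exists>\<^sub>F N in sequentially. s N < ennreal e"
  shows "liminf s = 0"
proof (rule ccontr)
  assume "liminf s \<noteq> 0"
  then have "0 < liminf s" by (simp add: zero_less_iff_neq_zero)
  then obtain y where y: "0 < y" "y < liminf s"
    using dense by blast
  then have "y < \<infinity>" by (simp add: order.strict_implies_not_eq less_top order_less_le_trans)
  then obtain e where e: "y = ennreal e" "0 < e"
    using y by (cases y) auto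
  have "\<forall>\<^sub>F N in sequentially. y < s N"
    using y(2) by (rule less_LiminfD)
  then have "\<exists>\<^sub>F N in sequentially. s N < y \<and> y < s N"
    using assms[OF e(2)] e(1) by (intro frequently_eventually_frequently) auto
  then have "\<exists>\<^sub>F N :: nat in sequentially. False"
    by (rule frequently_elim1) auto
  then show False by simp
qed

section \<open>Construction of the family and proof of its two properties\<close>

theorem theorem66:
  fixes M :: "'a measure" and p :: real
    and w :: "'a \<Rightarrow> 'k::{real_normed_field, euclidean_space}" and f :: "'a \<Rightarrow> 'a"
  assumes "1 \<le> p"
    and "weighted_composition M p w f"
    and "Metric_space.mean_Li_Yorke_chaotic (Lp M p) (Lp_dist M p) (weighted_comp_op M p w f)"
  shows "\<exists>(I :: nat set) (B :: nat \<Rightarrow> 'a set).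
    I \<noteq> {} \<and>
    (\<forall>i\<in>I. B i \<in> sets M \<and> 0 < emeasure M (B i) \<and> emeasure M (B i) < \<infinity>) \<and>
    (\<forall>i\<in>I. liminf (\<lambda>N.
       (\<Sum>n=1..N. ennreal_powr (iterated_measure M p w f n (iterated_preimage M f n (B i))) (1 / p))
         / of_nat N) = 0) \<and>
    (SUP (i, N) \<in> I \<times> {1..}.
       (\<Sum>n=1..N. iterated_measure M p w f n (iterated_preimage M f n (B i)) / emeasure M (B i))
         / of_nat N) = \<infinity>"
proof -
  note p = assms(1) and wc = assms(2)
  interpret Lp: Metric_space "Lp M p :: ('a \<Rightarrow> 'k) set set" "Lp_dist M p"
    by (rule Metric_space_Lp[OF p])
  let ?T = "weighted_comp_op M p w f"
  obtain S where S: "S \<subseteq> Lp M p" "uncountable S"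
    and SS: "\<forall>x\<in>S. \<forall>y\<in>S. x \<noteq> y \<longrightarrow>
      liminf (\<lambda>N. ereal ((\<Sum>n=1..N. Lp_dist M p ((?T ^^ n) x) ((?T ^^ n) y)) / real N)) = 0 \<and>
      limsup (\<lambda>N. ereal ((\<Sum>n=1..N. Lp_dist M p ((?T ^^ n) x) ((?T ^^ n) y)) / real N)) > 0"
    using assms(3) unfolding Lp.mean_Li_Yorke_chaotic_def by (elim exE conjE) (rule that)
  have "S \<noteq> {}"
    using S(2) by (rule contrapos_nn) simp
  then obtain x where x: "x \<in> S"
    by (auto simp only: ex_in_conv[symmetric])
  \<comment> \<open>A subset of a singleton is countable, so \<open>S\<close> has a second
    point.\<close>
  have "\<not> S \<subseteq> {x}"
    using S(2) by (rule contrapos_nn) (rule countable_subset, assumption, simp)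
  then obtain y where y: "y \<in> S" "x \<noteq> y"
    by blast
  obtain \<phi>x where \<phi>x: "\<phi>x \<in> Lp_fun M p" "x = Lp_class M p \<phi>x"
    by (rule Lp_cases[OF subsetD[OF S(1) x]])
  obtain \<phi>y where \<phi>y: "\<phi>y \<in> Lp_fun M p" "y = Lp_class M p \<phi>y"
    by (rule Lp_cases[OF subsetD[OF S(1) y(1)]])
  define \<phi> where "\<phi> = (\<lambda>t. \<phi>x t - \<phi>y t)"
  have \<phi>: "\<phi> \<in> Lp_fun M p"
    unfolding \<phi>_def by (rule Lp_fun_diff[OF p \<phi>x(1) \<phi>y(1)])
  define a where "a n = Lp_norm M p (weighted_iterate w f n \<phi>)" for n
  have a0: "0 \<le> a n" for n
    by (simp add: a_def Lp_norm_def)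
  have lim: "liminf (\<lambda>N. ereal ((\<Sum>n=1..N. a n) / real N)) = 0"
      "limsup (\<lambda>N. ereal ((\<Sum>n=1..N. a n) / real N)) > 0"
    using SS[rule_format, OF x y] unfolding \<phi>x(2) \<phi>y(2) a_def \<phi>_def
    by (simp_all add: Lp_dist_weighted_comp_op_funpow[OF wc \<phi>x(1) \<phi>y(1)])
  have freq: "\<exists>\<^sub>F N in sequentially. (\<Sum>n=1..N. a n) / N < e" if "0 < e" for e
    by (rule frequently_less_of_liminf[OF lim(1) that])
  have small: "\<exists>k. a k < e" if e: "0 < e" for e
  proof (rule ccontr)
    assume "\<not> ?thesis"
    then have ge: "\<And>k. e \<le> a k" by (meson not_less)
    \<comment> \<open>N = 0 is excluded because the mean there is 0 by convention.\<close>
    obtain N where N: "N \<ge> 1" "(\<Sum>n=1..N. a n) / N < e"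
      using freq[OF e] unfolding frequently_sequentially by blast
    have "real N * e \<le> (\<Sum>n=1..N. a n)"
      using sum_bounded_below[of "{1..N}" e a] ge by simp
    then show False using N by (simp add: field_simps)
  qed
  define \<psi> where "\<psi> k = weighted_iterate w f k \<phi>" for k
  have \<psi>: "\<psi> k \<in> Lp_fun M p" "\<psi> k \<in> borel_measurable M" for k
    using weighted_iterate_Lp_fun[OF wc \<phi>, of k] by (auto simp: \<psi>_def Lp_fun_def)
  have a\<psi>: "Lp_norm M p (weighted_iterate w f n (\<psi> k)) = a (n + k)" for n k
    by (simp add: a_def \<psi>_def weighted_iterate_add)
  \<comment> \<open>One natural number encodes both the iterate \<open>k\<close> and the integer
    level; \<open>I\<close> then selects the levels of positive measure.\<close>
  define B where "B m = (case prod_decode m of (k, j) \<Rightarrow> dyadic_level M (\<psi> k) (int_decode j))" for m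
  define I where "I = {m. 0 < emeasure M (B m)}"
  define \<nu> where "\<nu> n E = iterated_measure M p w f n (iterated_preimage M f n E)" for n E
  have "B i \<in> sets M \<and> 0 < emeasure M (B i) \<and> emeasure M (B i) < \<infinity>" if "i \<in> I" for i
    using that by (auto simp: I_def B_def dyadic_level_sets[OF \<psi>(2)]
        emeasure_dyadic_level_finite[OF p \<psi>(1), simplified] split: prod.splits)
  moreover have "liminf (\<lambda>N. (\<Sum>n=1..N. ennreal_powr (\<nu> n (B i)) (1 / p)) / of_nat N) = 0" for i
  proof (rule liminf_ennreal_eq_0)
    fix e :: real assume e: "0 < e"
    obtain k j where kj: "prod_decode i = (k, j)" by (cases "prod_decode i")
    define r where "r = 2 powr real_of_int (int_decode j)"
    have r: "0 < r" by (simp add: r_def)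
    have le: "ennreal_powr (\<nu> n (B i)) (1 / p) \<le> ennreal (a (n + k) / r)" for n
      using iterated_measure_dyadic_level_le[OF p wc \<psi>(1), of n k "int_decode j"]
      by (simp add: B_def kj r_def \<nu>_def a\<psi>)
    \<comment> \<open>The threshold e r anticipates the division by \<open>r\<close>, the lower
      bound of |\<psi> k| on this level.\<close>
    have "\<exists>\<^sub>F N in sequentially. (\<Sum>n=1..N. a (n + k)) / N < e * r"
      using frequently_Cesaro_shift_less[OF a0 freq, of "e * r" k] e r by simp
    then have "\<exists>\<^sub>F N in sequentially. (\<Sum>n=1..N. a (n + k)) / N < e * r \<and> 0 < N"
      using eventually_gt_at_top[of 0] by (rule frequently_eventually_frequently)
    then show "\<exists>\<^sub>F N in sequentially.
        (\<Sum>n=1..N. ennreal_powr (\<nu> n (B i)) (1 / p)) / of_nat N < ennreal e"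
    proof (rule frequently_elim1)
      fix N :: nat assume N: "(\<Sum>n=1..N. a (n + k)) / N < e * r \<and> 0 < N"
      have "(\<Sum>n=1..N. ennreal_powr (\<nu> n (B i)) (1 / p)) \<le> (\<Sum>n=1..N. ennreal (a (n + k) / r))"
        by (intro sum_mono le)
      also have "\<dots> = ennreal ((\<Sum>n=1..N. a (n + k)) / r)"
        using a0 r by (subst sum_ennreal) (auto simp: sum_divide_distrib)
      finally have "(\<Sum>n=1..N. ennreal_powr (\<nu> n (B i)) (1 / p)) / of_nat N
          \<le> ennreal ((\<Sum>n=1..N. a (n + k)) / r) / of_nat N"
        by (rule divide_right_mono_ennreal)
      also have "\<dots> = ennreal ((\<Sum>n=1..N. a (n + k)) / r / N)"
        using N a0 r by (simp add: ennreal_of_nat_eq_real_of_nat divide_ennreal sum_nonneg)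
      also have "\<dots> < ennreal e"
        using N r e by (intro ennreal_lessI) (auto simp: field_simps)
      finally show "(\<Sum>n=1..N. ennreal_powr (\<nu> n (B i)) (1 / p)) / of_nat N < ennreal e" .
    qed
  qed
  moreover have sup: "(SUP (i, N) \<in> I \<times> {1..}. (\<Sum>n=1..N. \<nu> n (B i) / emeasure M (B i)) / of_nat N) = \<infinity>"
    (is "?s = \<infinity>")
  proof (rule ccontr)
    assume "?s \<noteq> \<infinity>"
    then obtain C where C: "?s = ennreal C" "0 \<le> C"
      by (cases ?s) auto
    \<comment> \<open>The finite supremum bounds the members of the family; the null levels are
      added here, so that every level of every iterate is covered.\<close>
    have le: "(\<Sum>n=1..N. \<nu> n (dyadic_level M (\<psi> k) i)) \<le> ennreal (C * N) * emeasure M (dyadic_level M (\<psi> k) i)"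
      if N: "1 \<le> N" for k i and N :: nat
    proof -
      define L where "L = dyadic_level M (\<psi> k) i"
      have L: "L \<in> sets M" "emeasure M L < \<infinity>"
        unfolding L_def
        by (rule dyadic_level_sets[OF \<psi>(2)], rule emeasure_dyadic_level_finite[OF p \<psi>(1)])
      show ?thesis
      proof (cases "emeasure M L = 0")
        case True
        then show ?thesis
          using iterated_measure_preimage_null[OF wc L(1)] by (simp add: \<nu>_def L_def)
      next
        case False
        define m where "m = prod_encode (k, int_encode i)"
        have BL: "B m = L" by (simp add: B_def m_def L_def)
        have "(m, N) \<in> I \<times> {1..}"
          using False N by (simp add: I_def BL zero_less_iff_neq_zero)
        then have "(\<Sum>n=1..N. \<nu> n L / emeasure M L) / of_nat N \<le> ?s"
          by (intro SUP_upper2[of "(m, N)"]) (auto simp: BL)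
        also have "(\<Sum>n=1..N. \<nu> n L / emeasure M L) = (\<Sum>n=1..N. \<nu> n L) / emeasure M L"
          by (simp add: divide_ennreal_def sum_distrib_right)
        finally have "(\<Sum>n=1..N. \<nu> n L) / emeasure M L / of_nat N \<le> ennreal C"
          unfolding C(1) .
        then have "(\<Sum>n=1..N. \<nu> n L) / emeasure M L / of_nat N * of_nat N * emeasure M L
            \<le> ennreal C * of_nat N * emeasure M L"
          by (intro mult_right_mono) auto
        moreover have "(\<Sum>n=1..N. \<nu> n L) / emeasure M L / of_nat N * of_nat N * emeasure M L
            = (\<Sum>n=1..N. \<nu> n L)"
        proof -
          \<comment> \<open>Cancellation in \<open>ennreal\<close> needs a divisor that is neither 0
            nor infinite; it is applied to the measure of \<open>L\<close> and to N.\<close>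
          have cancel: "y / b * b = y" if "b \<noteq> 0" "b < \<infinity>" for y b :: ennreal
            using that by (simp add: ennreal_divide_times ennreal_divide_self)
          have N': "of_nat N \<noteq> (0 :: ennreal)" "of_nat N < (\<infinity> :: ennreal)"
            using N by (auto simp: of_nat_less_top)
          show ?thesis
            by (simp only: cancel[OF False L(2)] cancel[OF N'])
        qed
        ultimately show ?thesis
          using C by (simp add: L_def ennreal_mult ennreal_of_nat_eq_real_of_nat)
      qed
    qed
    \<comment> \<open>The constant is the same for all \<open>k\<close>, as the supremum runs over
      the levels of all iterates; hence \<open>k\<close> can be chosen with a k small.\<close>
    have bound: "(\<Sum>n=1..N. a (n + k) powr p) \<le> (2 powr p * C) * N * a k powr p" for N k
    proof (cases "N = 0")
      case False
      then have "(\<Sum>n=1..N. a (n + k) powr p) \<le> 2 powr p * (C * N) * Lp_norm M p (\<psi> k) powr p"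
        unfolding a\<psi>[symmetric]
        by (intro sum_Lp_norm_iterates_le[OF p wc \<psi>(1)] le[unfolded \<nu>_def]) (use C(2) in auto)
      then show ?thesis
        by (simp add: a_def \<psi>_def mult_ac)
    qed simp
    have "limsup (\<lambda>N. ereal ((\<Sum>n=1..N. a n) / real N)) \<le> ereal e" if "0 < e" for e
      using Cesaro_eventually_le[OF p a0 _ small bound that] C(2)
      by (intro Limsup_bounded) simp
    then have "limsup (\<lambda>N. ereal ((\<Sum>n=1..N. a n) / real N)) \<le> 0"
      using ereal_le_epsilon2[of _ 0] by simp
    then show False using lim(2) by simp
  qed
  \<comment> \<open>Over an empty index set the supremum in \<open>ennreal\<close> would be
    0.\<close>
  moreover have "I \<noteq> {}"
  proof
    assume "I = {}"
    with sup show False by (simp add: bot_ennreal)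
  qed
  ultimately show ?thesis
    unfolding \<nu>_def by blast
qed

end
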